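(* Let $f$ be a holomorphic function on $\mathbb{D}$ with $|f|\le1$. Then, for $z\in\mathbb{D}$, $$\left|\frac{D_3f(z)}{6}\bigl(1-|D_1f(z)|^2\bigr)+\overline{D_1f(z)}\left(\frac{D_2f(z)}{2}\right)^2\right|+\left|\frac{D_2f(z)}{2}\right|^2\le(1-|D_1f(z)|^2)^2,$$ where equality holds for a point $z\in\mathbb{D}$ if and only if $f$ is a Blaschke product of degree at most $3$.
   Context: $\mathbb{D}=\{z\in\mathbb{C}:|z|<1\}$. For $z,w\in\mathbb{D}$ put $[z,w]=\dfrac{z-w}{1-\overline{w}z}$, and put $[z,z]=0$ for $z\in\partial\mathbb{D}$, so that $[f(z),f(w)]$ is defined for every holomorphic $f$ on $\mathbb{D}$ with $|f|\le 1$ and all $z,w\in\mathbb{D}$. A (finite) Blaschke product of degree $n$ ($n\ge0$) is a function of the form $e^{i\theta}\prod_{j=1}^n[z,a_j]$ with $\theta\in\mathbb{R}$ and $a_1,\dots,a_n\in\mathbb{D}$. Peschl's invariant derivatives $D_nf(z_0)$, $n\ge1$, $z_0\in\mathbb{D}$, are defined by the series expansion $$[f([z,-z_0]),f(z_0)]=\frac{f\left(\frac{z+z_0}{1+\bar z_0z}\right)-f(z_0)}{1-\overline{f(z_0)}f\left(\frac{z+z_0}{1+\bar z_0z}\right)}=\sum_{n=1}^\infty\frac{D_nf(z_0)}{n!}z^n,\qquad z\in\mathbb{D}.$$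
   Formalization: The equality case is stated for Blaschke products of degree 1, 2 or 3 instead of degree at most 3, since for degree 0 (unimodular constants) all D_n f vanish and the inequality reads 0 ≤ 1, so equality fails. *)

theory Defs
  imports "HOL-Complex_Analysis.Complex_Analysis"
begin

text \<open>
  \<open>dbracket z w\<close> is $[z,w] = (z - w) / (1 - \overline{w} z)$. For $z = w$ on the unit circle both
  numerator and denominator vanish and \<open>0 / 0 = 0\<close>, so the convention $[z,z] = 0$ there holds.
\<close>

definition dbracket :: "complex \<Rightarrow> complex \<Rightarrow> complex" where
  "dbracket z w = Moebius_function 0 w z"

lemma dbracket_altdef: "dbracket z w = (z - w) / (1 - cnj w * z)"
  by (simp add: dbracket_def Moebius_function_simple)

lemma dbracket_self [simp]: "dbracket z z = 0"
  by (simp add: dbracket_altdef)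

text \<open>
  The functions under consideration live on the unit disc; their values outside it are irrelevant.
\<close>

definition is_blaschke_product :: "nat \<Rightarrow> (complex \<Rightarrow> complex) \<Rightarrow> bool" where
  "is_blaschke_product n f \<longleftrightarrow>
     (\<exists>(\<theta>::real) (a :: nat \<Rightarrow> complex). (\<forall>j\<in>{1..n}. a j \<in> ball 0 1) \<and>
        (\<forall>z\<in>ball 0 1. f z = exp (\<i> * of_real \<theta>) * (\<Prod>j=1..n. dbracket z (a j))))"

definition peschl_aux :: "(complex \<Rightarrow> complex) \<Rightarrow> complex \<Rightarrow> complex \<Rightarrow> complex" where
  "peschl_aux f z0 z = dbracket (f (dbracket z (- z0))) (f z0)"

text \<open>
  \<open>peschl_deriv n f z0\<close> is $D_n f(z_0)$: the $n$-th coefficient of the power series of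
  \<open>peschl_aux f z0\<close> about \<open>0\<close>, times $n!$. Lemma \<open>peschl_deriv_sums\<close> below confirms that the
  expansion holds on the whole disc.
\<close>

definition peschl_deriv :: "nat \<Rightarrow> (complex \<Rightarrow> complex) \<Rightarrow> complex \<Rightarrow> complex" where
  "peschl_deriv n f z0 = fact n * fps_nth (fps_expansion (peschl_aux f z0) 0) n"

lemma dbracket_in_disc:
  assumes "z \<in> ball 0 1" "w \<in> ball 0 1"
  shows "dbracket z w \<in> ball 0 1"
  using assms Moebius_function_norm_lt_1 by (auto simp: dbracket_def)

lemma peschl_aux_holomorphic:
  assumes f: "f holomorphic_on ball 0 1" and le: "\<And>w. w \<in> ball 0 1 \<Longrightarrow> norm (f w) \<le> 1"
    and z0: "z0 \<in> ball 0 1"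
  shows "peschl_aux f z0 holomorphic_on ball 0 1"
proof (cases "\<exists>w\<in>ball 0 1. norm (f w) = 1")
  case True
  then obtain w where w: "w \<in> ball 0 1" "norm (f w) = 1" by blast
  have "f constant_on ball 0 1"
    by (rule maximum_modulus_principle[OF f, of "ball 0 1" w]) (use w le in auto)
  then obtain c where c: "\<And>z. z \<in> ball 0 1 \<Longrightarrow> f z = c"
    by (auto simp: constant_on_def)
  have "peschl_aux f z0 z = 0" if "z \<in> ball 0 1" for z
    using c[OF dbracket_in_disc[OF that, of "- z0"]] c[OF z0] z0 by (simp add: peschl_aux_def)
  then show ?thesis
    by (subst holomorphic_cong[OF refl, of _ _ "\<lambda>_. 0"]) auto
next
  case False
  with le have lt: "norm (f w) < 1" if "w \<in> ball 0 1" for w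
    using that by (meson order_le_less)
  have M: "Moebius_function 0 w holomorphic_on ball 0 1" if "norm w < 1" for w
    using that by (rule Moebius_function_holomorphic)
  have "(Moebius_function 0 (f z0) \<circ> (f \<circ> Moebius_function 0 (- z0))) holomorphic_on ball 0 1"
  proof (rule holomorphic_on_compose_gen)
    show "f \<circ> Moebius_function 0 (- z0) holomorphic_on ball 0 1"
      using z0 by (intro holomorphic_on_compose_gen[OF M f])
        (use Moebius_function_norm_lt_1 in auto)
    show "Moebius_function 0 (f z0) holomorphic_on ball 0 1"
      using lt[OF z0] by (rule M)
    show "(f \<circ> Moebius_function 0 (- z0)) ` ball 0 1 \<subseteq> ball 0 1"
      using z0 lt Moebius_function_norm_lt_1 by fastforce
  qed
  then show ?thesis
    by (simp add: peschl_aux_def[abs_def] dbracket_def o_def)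
qed

lemma peschl_deriv_sums:
  assumes f: "f holomorphic_on ball 0 1" and le: "\<And>w. w \<in> ball 0 1 \<Longrightarrow> norm (f w) \<le> 1"
    and z0: "z0 \<in> ball 0 1" and z: "z \<in> ball 0 1"
  shows "(\<lambda>n. peschl_deriv (Suc n) f z0 / fact (Suc n) * z ^ Suc n) sums
           dbracket (f (dbracket z (- z0))) (f z0)"
proof -
  have "(\<lambda>n. peschl_deriv n f z0 / fact n * z ^ n) sums peschl_aux f z0 z"
    using holomorphic_power_series[OF peschl_aux_holomorphic[OF f le z0] z]
    by (simp add: peschl_deriv_def fps_expansion_def)
  moreover have "peschl_deriv 0 f z0 = 0"
    by (simp add: peschl_deriv_def fps_expansion_def peschl_aux_def dbracket_altdef)
  ultimately have "(\<lambda>n. peschl_deriv (Suc n) f z0 / fact (Suc n) * z ^ Suc n) sums peschl_aux f z0 z"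
    using sums_Suc_iff[of "\<lambda>n. peschl_deriv n f z0 / fact n * z ^ n" "peschl_aux f z0 z"]
    by (simp del: power_Suc fact_Suc)
  then show ?thesis by (simp add: peschl_aux_def)
qed

end

theory Submission
  imports Defs "HOL-Computational_Algebra.Fundamental_Theorem_Algebra"
begin

text \<open>
  The proof is the Schur algorithm. Call \<open>f\<close> a Schur function if it is holomorphic on the unit disc
  with \<open>\<bar>f\<bar> \<le> 1\<close>. If \<open>\<bar>f 0\<bar> < 1\<close>, then \<open>[f z, f 0]\<close> vanishes at \<open>0\<close>, and by the Schwarz lemma
  \<open>[f z, f 0] = z * g z\<close> for another Schur function \<open>g\<close> (\<open>schur_step\<close>). If \<open>\<bar>f 0\<bar> = 1\<close>, then \<open>f\<close> is
  constant by the maximum principle and the algorithm stops.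

  If \<open>\<bar>f z\<^sub>0\<bar> < 1\<close>, Peschl's invariant derivatives of \<open>f\<close> at \<open>z\<^sub>0\<close> come from one such step with \<open>z\<^sub>0\<close> in
  place of \<open>0\<close>: it yields a Schur function \<open>h\<close> with \<open>h z = c\<^sub>0 + c\<^sub>1 z + c\<^sub>2 z\<^sup>2 + \<dots>\<close>, where \<open>c\<^sub>n\<close> is the
  derivative of order \<open>n + 1\<close> divided by \<open>(n + 1)!\<close> (\<open>peschl_deriv_eq_schur_coeff\<close>). Put
  \<open>d = 1 - \<bar>c\<^sub>0\<bar>\<^sup>2\<close>. If \<open>d = 0\<close>, then \<open>h\<close> is constant and both sides of the inequality vanish.
  Otherwise a second step takes \<open>h\<close> to a Schur function \<open>b\<^sub>0 + b\<^sub>1 z + \<dots>\<close>, and comparing coefficients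
  gives \<open>c\<^sub>1 = d * b\<^sub>0\<close> and \<open>c\<^sub>2 * d + cnj c\<^sub>0 * c\<^sub>1\<^sup>2 = d\<^sup>2 * b\<^sub>1\<close>. So after division by \<open>d\<^sup>2\<close> the claimed
  inequality is the Schwarz-Pick inequality \<open>\<bar>b\<^sub>1\<bar> + \<bar>b\<^sub>0\<bar>\<^sup>2 \<le> 1\<close>. It is an equality if \<open>\<bar>b\<^sub>0\<bar> = 1\<close>, and
  otherwise a third step turns it into the bound \<open>1\<close> for the value at \<open>0\<close> of the resulting function.

  Thus equality holds exactly when the first, second or third step produces a unimodular constant.
  What remains is that a step lowers the degree of a Blaschke product by exactly one, in both
  directions: \<open>f\<close> is one of degree \<open>n + 1\<close> iff \<open>g\<close> is one of degree \<open>n\<close>. This rests on the fact that \<open>[f, c]\<close> is a Blaschke product of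
  the same degree as \<open>f\<close> (\<open>is_blaschke_product_dbracket_left\<close>).
\<close>

section \<open>Elementary estimates for linear factors\<close>

lemma dbracket_0_right [simp]: "dbracket z 0 = z"
  by (simp add: dbracket_altdef)

lemma norm_one_minus_cnj_mult_le:
  assumes "norm a < 1" "norm z \<ge> 1"
  shows "norm (1 - cnj a * z) \<le> norm (z - a)"
proof -
  have "(norm (z - a))\<^sup>2 - (norm (1 - cnj a * z))\<^sup>2 = ((norm z)\<^sup>2 - 1) * (1 - (norm a)\<^sup>2)"
    unfolding cmod_power2 by (simp add: power2_eq_square algebra_simps)
  moreover have "((norm z)\<^sup>2 - 1) * (1 - (norm a)\<^sup>2) \<ge> 0"
    using assms by (intro mult_nonneg_nonneg) (auto simp: power_le_one)
  ultimately have "(norm (1 - cnj a * z))\<^sup>2 \<le> (norm (z - a))\<^sup>2" by linarith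
  then show ?thesis by (rule power2_le_imp_le) simp
qed

lemma norm_mult_less_one:
  fixes a b :: complex
  assumes "norm a < 1" "norm b \<le> 1"
  shows "norm (a * b) < 1"
proof -
  have "norm a * norm b \<le> norm a" using assms by (intro mult_left_le) auto
  with assms show ?thesis by (simp add: norm_mult)
qed

lemma one_minus_mult_nonzero:
  fixes a b :: complex
  assumes "norm a < 1" "norm b \<le> 1"
  shows "1 - a * b \<noteq> 0" "1 + a * b \<noteq> 0"
  using norm_mult_less_one[OF assms] norm_mult_less_one[of "-a" b] assms
  by (auto simp: add_eq_0_iff)

section \<open>Composition of a Blaschke product with a disc automorphism\<close>

text \<open>
  A Blaschke product with zeros \<open>A\<close> is \<open>u * bnum A z / bden A z\<close> with \<open>\<bar>u\<bar> = 1\<close>; a multiset records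
  multiple zeros without an arbitrary numbering.
\<close>

definition bnum :: "complex multiset \<Rightarrow> complex \<Rightarrow> complex" where
  "bnum A z = (\<Prod>a\<in>#A. z - a)"

definition bden :: "complex multiset \<Rightarrow> complex \<Rightarrow> complex" where
  "bden A z = (\<Prod>a\<in>#A. 1 - cnj a * z)"

lemma prod_dbracket_eq: "(\<Prod>a\<in>#A. dbracket z a) = bnum A z / bden A z"
  by (induction A) (auto simp: bnum_def bden_def dbracket_altdef)

text \<open>
  Numerator and denominator are exchanged by reflection in the unit circle, which sends \<open>z\<close> to
  \<open>1 / cnj z\<close>.
\<close>

lemma bden_eq_reflected_bnum:
  "z \<noteq> 0 \<Longrightarrow> bden A z = z ^ size A * cnj (bnum A (inverse (cnj z)))"
  by (induction A) (auto simp: bnum_def bden_def field_simps)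

lemma bnum_eq_reflected_bden:
  "z \<noteq> 0 \<Longrightarrow> bnum A z = z ^ size A * cnj (bden A (inverse (cnj z)))"
  by (induction A) (auto simp: bnum_def bden_def field_simps)

lemma norm_bden_le_norm_bnum:
  assumes "\<forall>a\<in>#A. norm a < 1" "norm z \<ge> 1"
  shows "norm (bden A z) \<le> norm (bnum A z)"
  using assms(1)
proof (induction A)
  case (add a A)
  then show ?case
    using norm_one_minus_cnj_mult_le[of a z] assms(2)
    by (auto simp: bnum_def bden_def norm_mult intro!: mult_mono)
qed (auto simp: bnum_def bden_def)

lemma bden_nonzero:
  assumes "\<forall>a\<in>#A. norm a < 1" "norm z \<le> 1"
  shows "bden A z \<noteq> 0"
  using assms(1)
proof (induction A)
  case (add a A)
  have "1 - cnj a * z \<noteq> 0"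
    using add.prems assms(2) by (intro one_minus_mult_nonzero) auto
  then show ?case using add by (auto simp: bden_def)
qed (auto simp: bden_def)

lemma bnum_nonzero:
  assumes "\<forall>a\<in>#A. norm a < 1" "norm z \<ge> 1"
  shows "bnum A z \<noteq> 0"
  using assms by (auto simp: bnum_def)

text \<open>
  For the factors \<open>1 - cnj a * z\<close> of \<open>bden\<close> the degree drops when \<open>a = 0\<close>, so the coefficient that
  matters is the one of order \<open>size A\<close>, which may differ from the leading one.
\<close>

lemma prod_mset_linear_poly:
  fixes b :: "complex \<Rightarrow> complex"
  shows "degree (\<Prod>a\<in>#A. [:b a, c a:]) \<le> size A \<and> coeff (\<Prod>a\<in>#A. [:b a, c a:]) (size A) = (\<Prod>a\<in>#A. c a)"
proof (induction A)
  case (add a A)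
  let ?p = "\<Prod>a\<in>#A. [:b a, c a:]"
  have "degree ([:b a, c a:] * ?p) \<le> degree [:b a, c a:] + degree ?p"
    by (rule degree_mult_le)
  also have "\<dots> \<le> 1 + size A" using add by (intro add_mono) auto
  finally have "degree ([:b a, c a:] * ?p) \<le> Suc (size A)" by simp
  moreover have "coeff ?p (Suc (size A)) = 0"
    using add by (intro coeff_eq_0) auto
  ultimately show ?case using add by (auto simp: mult_pCons_left)
qed auto

text \<open>
  Let \<open>R = u * bnum A - c * bden A\<close> and \<open>n = size A\<close>. Its coefficient \<open>l\<close> of order \<open>n\<close> is nonzero,
  because \<open>u\<close> is unimodular and the other contribution has modulus at most \<open>\<bar>c\<bar> < 1\<close>; so \<open>R\<close> has \<open>n\<close>
  roots. None lies outside the open disc, because there \<open>\<bar>bden A\<bar> \<le> \<bar>bnum A\<bar>\<close>, so the first term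
  dominates. The second factorization is the reflection of the first in the unit circle.
\<close>

lemma bnum_minus_bden_factorization:
  assumes A: "\<forall>a\<in>#A. norm a < 1" and u: "norm u = 1" and c: "norm c < 1"
  obtains l B where "l \<noteq> 0" "size B = size A" "\<forall>b\<in>#B. norm b < 1"
    "\<And>z. u * bnum A z - c * bden A z = l * bnum B z"
    "\<And>z. bden A z - cnj c * u * bnum A z = u * cnj l * bden B z"
proof -
  define P where "P = (\<Prod>a\<in>#A. [:- a, 1:])"
  define Q where "Q = (\<Prod>a\<in>#A. [:1, - cnj a:])"
  define R where "R = smult u P - smult c Q"
  define l where "l = u - c * (\<Prod>a\<in>#A. - cnj a)"
  have P: "poly P z = bnum A z" for z by (simp add: P_def poly_prod_mset bnum_def algebra_simps)
  have Q: "poly Q z = bden A z" for z by (simp add: Q_def poly_prod_mset bden_def algebra_simps)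
  have nPQ: "degree P \<le> size A" "coeff P (size A) = 1"
       "degree Q \<le> size A" "coeff Q (size A) = (\<Prod>a\<in>#A. - cnj a)"
    using prod_mset_linear_poly[where A=A and b=uminus and c="\<lambda>_. 1"]
      prod_mset_linear_poly[where A=A and b="\<lambda>_. 1" and c="\<lambda>a. - cnj a"]
    by (simp_all add: P_def Q_def)
  have "norm (\<Prod>a\<in>#A. - cnj a) \<le> 1"
    using A by (induction A) (auto simp: norm_mult intro!: mult_le_one)
  hence "norm (c * (\<Prod>a\<in>#A. - cnj a)) < 1"
    using c by (rule norm_mult_less_one[rotated])
  hence l: "l \<noteq> 0" using u by (auto simp: l_def)
  have coeffR: "coeff R (size A) = l" by (simp add: R_def l_def nPQ)
  have degR: "degree R = size A"
  proof (rule antisym)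
    show "degree R \<le> size A"
      unfolding R_def using nPQ by (intro degree_diff_le order.trans[OF degree_smult_le])
    show "size A \<le> degree R" using coeffR l by (intro le_degree) auto
  qed
  hence "R \<noteq> 0" "lead_coeff R = l" using coeffR l by auto
  then obtain B where B: "size B = size A" "R = smult l (\<Prod>x\<in>#B. [:-x, 1:])"
    using alg_closed_imp_factorization[of R] degR by auto
  have R: "poly R z = u * bnum A z - c * bden A z" for z by (simp add: R_def P Q)
  have RB: "poly R z = l * bnum B z" for z by (simp add: B poly_prod_mset bnum_def algebra_simps)
  have Bin: "\<forall>b\<in>#B. norm b < 1"
  proof (intro ballI, rule ccontr)
    fix b assume b: "b \<in># B" "\<not> norm b < 1"
    have "bnum B b = 0" using b by (auto simp: bnum_def)
    hence "u * bnum A b = c * bden A b" using R[of b] RB[of b] by simp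
    hence "norm (bnum A b) = norm c * norm (bden A b)" using u by (metis norm_mult mult_1)
    also have "\<dots> \<le> norm c * norm (bnum A b)"
      using norm_bden_le_norm_bnum[OF A, of b] b by (intro mult_left_mono) auto
    also have "\<dots> < norm (bnum A b)"
      using c bnum_nonzero[OF A, of b] b by auto
    finally show False by simp
  qed
  have uu: "u * cnj u = 1" using u by (simp add: complex_norm_square[symmetric])
  have "bden A z - cnj c * u * bnum A z = u * cnj l * bden B z" for z
  proof (cases "z = 0")
    \<comment> \<open>The origin has no finite reflection; there the claim is the formula for \<open>l\<close>.\<close>
    case True
    have "(\<Prod>a\<in>#A. - a) = cnj (\<Prod>a\<in>#A. - cnj a)"
      by (induction A) auto
    then show ?thesis
      using True uu by (simp add: bden_def bnum_def l_def algebra_simps)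
  next
    case False
    let ?w = "inverse (cnj z)"
    have "u * cnj l * bden B z = u * (z ^ size A * cnj (l * bnum B ?w))"
      using False by (simp add: bden_eq_reflected_bnum B)
    also have "l * bnum B ?w = u * bnum A ?w - c * bden A ?w"
      using R[of ?w] RB[of ?w] by simp
    also have "u * (z ^ size A * cnj \<dots>) = (u * cnj u) * (z ^ size A * cnj (bnum A ?w)) - cnj c * u * (z ^ size A * cnj (bden A ?w))"
      by (simp add: algebra_simps)
    also have "\<dots> = bden A z - cnj c * u * bnum A z"
      using False by (simp add: uu bden_eq_reflected_bnum[of z A] bnum_eq_reflected_bden[of z A])
    finally show ?thesis by simp
  qed
  then show thesis using that[of l B] l B Bin R RB by metis
qed

lemma is_blaschke_product_iff_mset:
  "is_blaschke_product n f \<longleftrightarrow>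
    (\<exists>u A. norm u = 1 \<and> size A = n \<and> (\<forall>a\<in>#A. norm a < 1) \<and>
       (\<forall>z\<in>ball 0 1. f z = u * (\<Prod>a\<in>#A. dbracket z a)))" (is "?L \<longleftrightarrow> ?R")
proof
  assume ?L
  then obtain \<theta> :: real and a :: "nat \<Rightarrow> complex" where a: "\<forall>j\<in>{1..n}. a j \<in> ball 0 1"
    "\<forall>z\<in>ball 0 1. f z = exp (\<i> * of_real \<theta>) * (\<Prod>j=1..n. dbracket z (a j))"
    by (auto simp: is_blaschke_product_def)
  show ?R
    by (rule exI[of _ "exp (\<i> * of_real \<theta>)"], rule exI[of _ "image_mset a (mset_set {1..n})"])
       (use a in \<open>auto simp: image_mset.compositionality o_def prod_unfold_prod_mset\<close>)
next
  assume ?R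
  then obtain u A where A: "norm u = 1" "size A = n" "\<forall>a\<in>#A. norm a < 1"
       "\<forall>z\<in>ball 0 1. f z = u * (\<Prod>a\<in>#A. dbracket z a)" by blast
  obtain xs where xs: "mset xs = A" using ex_mset by blast
  have len: "length xs = n" using A xs by auto
  define a where "a j = xs ! (j - 1)" for j
  have map: "map a [1..<Suc n] = xs"
    by (rule nth_equalityI) (auto simp: len a_def nth_append simp del: upt_Suc)
  have "image_mset a (mset [1..<Suc n]) = A"
    using map xs by (metis mset_map)
  hence img: "image_mset a (mset_set {1..n}) = A"
    by (simp add: atLeastLessThanSuc_atLeastAtMost del: upt_Suc)
  have "(\<Prod>j=1..n. dbracket z (a j)) = (\<Prod>a\<in>#A. dbracket z a)" for z
    by (simp add: img[symmetric] image_mset.compositionality o_def prod_unfold_prod_mset)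
  moreover have "u = exp (\<i> * of_real (Arg u))"
    using A(1) by (metis Arg_eq norm_eq_zero mult_1 of_real_1 zero_neq_one)
  moreover have "a j \<in> ball 0 1" if "j \<in> {1..n}" for j
  proof -
    have "a j \<in> set xs" using that len by (auto simp: a_def)
    thus ?thesis using A xs by auto
  qed
  ultimately show ?L using A(4) unfolding is_blaschke_product_def
    by (intro exI[of _ "Arg u"] exI[of _ a]) auto
qed

text \<open>
  With \<open>f = u * P / Q\<close> one has \<open>[f, c] = (u * P - c * Q) / (Q - cnj c * u * P)\<close>, and
  \<open>bnum_minus_bden_factorization\<close> factors numerator and denominator with the same zeros.
\<close>

lemma is_blaschke_product_dbracket_left:
  assumes "is_blaschke_product n f" and c: "norm c < 1"
  shows "is_blaschke_product n (\<lambda>z. dbracket (f z) c)"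
proof -
  obtain u A where A: "norm u = 1" "size A = n" "\<forall>a\<in>#A. norm a < 1"
       "\<forall>z\<in>ball 0 1. f z = u * (\<Prod>a\<in>#A. dbracket z a)"
    using assms(1) unfolding is_blaschke_product_iff_mset by blast
  obtain l B where B: "l \<noteq> 0" "size B = size A" "\<forall>b\<in>#B. norm b < 1"
    "\<And>z. u * bnum A z - c * bden A z = l * bnum B z"
    "\<And>z. bden A z - cnj c * u * bnum A z = u * cnj l * bden B z"
    using bnum_minus_bden_factorization[OF A(3) A(1) c] by blast
  have "dbracket (f z) c = l / (u * cnj l) * (\<Prod>b\<in>#B. dbracket z b)" if "z \<in> ball 0 1" for z
  proof -
    have nz: "bden A z \<noteq> 0" using that A by (intro bden_nonzero) auto
    have "dbracket (f z) c = (u * bnum A z / bden A z - c) / (1 - cnj c * (u * bnum A z / bden A z))"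
      using A(4) that by (simp add: prod_dbracket_eq) (simp add: dbracket_altdef)
    also have "\<dots> = (u * bnum A z - c * bden A z) / (bden A z - cnj c * u * bnum A z)"
      using nz by (simp add: divide_simps)
    also have "\<dots> = l / (u * cnj l) * (bnum B z / bden B z)" by (simp add: B)
    finally show ?thesis by (simp add: prod_dbracket_eq)
  qed
  moreover have "norm (l / (u * cnj l)) = 1"
    using B A by (simp add: norm_divide norm_mult)
  ultimately show ?thesis
    unfolding is_blaschke_product_iff_mset using B A by metis
qed

text \<open>
  Two disc automorphisms compose to a disc automorphism; its zero is the preimage of \<open>a\<close>, namely
  \<open>[a, -w]\<close>, and the remaining factor is unimodular.
\<close>

lemma dbracket_dbracket_left:
  assumes "norm a < 1" "norm w < 1" "norm z < 1"
  shows "dbracket (dbracket z w) a = (1 + a * cnj w) / (1 + cnj a * w) * dbracket z (dbracket a (-w))"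
proof -
  have nz: "1 - cnj w * z \<noteq> 0" "1 + cnj a * w \<noteq> 0" "1 + a * cnj w \<noteq> 0"
    using one_minus_mult_nonzero[of "cnj w" z] one_minus_mult_nonzero[of "cnj a" w]
      one_minus_mult_nonzero[of a "cnj w"] assms by auto
  have "dbracket (dbracket z w) a = ((z - w) - a * (1 - cnj w * z)) / ((1 - cnj w * z) - cnj a * (z - w))"
    unfolding dbracket_altdef using nz(1) by (simp add: divide_simps)
  also have "(z - w) - a * (1 - cnj w * z) = (1 + a * cnj w) * (z - dbracket a (-w))"
    unfolding dbracket_altdef using nz(3) by (simp add: divide_simps) (simp add: algebra_simps)
  also have "(1 - cnj w * z) - cnj a * (z - w) = (1 + cnj a * w) * (1 - cnj (dbracket a (-w)) * z)"
    unfolding dbracket_altdef using nz(2) by (simp add: divide_simps) (simp add: algebra_simps)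
  finally show ?thesis by (simp add: dbracket_altdef)
qed

lemma is_blaschke_product_dbracket_right:
  assumes "is_blaschke_product n f" and w: "norm w < 1"
  shows "is_blaschke_product n (\<lambda>z. f (dbracket z w))"
proof -
  obtain u A where A: "norm u = 1" "size A = n" "\<forall>a\<in>#A. norm a < 1"
       "\<forall>z\<in>ball 0 1. f z = u * (\<Prod>a\<in>#A. dbracket z a)"
    using assms(1) unfolding is_blaschke_product_iff_mset by blast
  define v where "v a = (1 + a * cnj w) / (1 + cnj a * w)" for a
  define B where "B = image_mset (\<lambda>a. dbracket a (-w)) A"
  have "norm (v a) = 1" if "norm a < 1" for a
  proof -
    have "1 + cnj a * w \<noteq> 0" "1 + cnj a * w = cnj (1 + a * cnj w)"
      using one_minus_mult_nonzero[of "cnj a" w] w that by auto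
    thus ?thesis unfolding v_def norm_divide by (metis complex_mod_cnj div_self norm_eq_zero)
  qed
  hence "norm (\<Prod>a\<in>#A. v a) = 1" using A(3) by (induction A) (auto simp: norm_mult)
  hence "norm (u * (\<Prod>a\<in>#A. v a)) = 1" using A(1) by (simp add: norm_mult)
  moreover have "f (dbracket z w) = u * (\<Prod>a\<in>#A. v a) * (\<Prod>b\<in>#B. dbracket z b)" if "z \<in> ball 0 1" for z
  proof -
    have "(\<Prod>a\<in>#A. dbracket (dbracket z w) a) = (\<Prod>a\<in>#A. v a) * (\<Prod>b\<in>#B. dbracket z b)"
      unfolding B_def using A(3)
      by (induction A) (use that w in \<open>auto simp: dbracket_dbracket_left v_def\<close>)
    moreover have "dbracket z w \<in> ball 0 1" using dbracket_in_disc[of z w] that w by auto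
    ultimately show ?thesis using A(4) by (simp add: mult.assoc)
  qed
  moreover have "\<forall>b\<in>#B. norm b < 1" "size B = n"
    using dbracket_in_disc[of _ "-w"] A w by (auto simp: B_def)
  ultimately show ?thesis unfolding is_blaschke_product_iff_mset by blast
qed

lemma is_blaschke_product_cong:
  "(\<And>z. z \<in> ball 0 1 \<Longrightarrow> f z = g z) \<Longrightarrow> is_blaschke_product n f \<longleftrightarrow> is_blaschke_product n g"
  by (simp add: is_blaschke_product_def)

lemma dbracket_dbracket_uminus:
  assumes "norm c < 1" "norm w < 1"
  shows "dbracket (dbracket w c) (- c) = w" "dbracket (dbracket w (- c)) c = w"
  unfolding dbracket_def using assms by (simp_all add: Moebius_function_compose)

lemma is_blaschke_product_dbracket_left_iff:
  assumes "\<And>z. z \<in> ball 0 1 \<Longrightarrow> norm (f z) < 1" and c: "norm c < 1"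
  shows "is_blaschke_product n (\<lambda>z. dbracket (f z) c) \<longleftrightarrow> is_blaschke_product n f"
proof
  assume "is_blaschke_product n (\<lambda>z. dbracket (f z) c)"
  hence "is_blaschke_product n (\<lambda>z. dbracket (dbracket (f z) c) (- c))"
    by (rule is_blaschke_product_dbracket_left) (use c in auto)
  also have "?this \<longleftrightarrow> is_blaschke_product n f"
    using assms by (intro is_blaschke_product_cong) (auto simp: dbracket_dbracket_uminus)
  finally show "is_blaschke_product n f" .
qed (rule is_blaschke_product_dbracket_left[OF _ c])

lemma is_blaschke_product_dbracket_right_iff:
  assumes w: "norm w < 1"
  shows "is_blaschke_product n (\<lambda>z. f (dbracket z w)) \<longleftrightarrow> is_blaschke_product n f"
proof
  assume "is_blaschke_product n (\<lambda>z. f (dbracket z w))"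
  hence "is_blaschke_product n (\<lambda>z. f (dbracket (dbracket z (- w)) w))"
    by (rule is_blaschke_product_dbracket_right[where f="\<lambda>z. f (dbracket z w)"]) (use w in auto)
  also have "?this \<longleftrightarrow> is_blaschke_product n f"
    using assms by (intro is_blaschke_product_cong) (auto simp: dbracket_dbracket_uminus)
  finally show "is_blaschke_product n f" .
qed (rule is_blaschke_product_dbracket_right[OF _ w])

section \<open>Splitting off a zero at the origin\<close>

lemma is_blaschke_product_holomorphic:
  assumes "is_blaschke_product n f"
  shows "f holomorphic_on ball 0 1"
proof -
  obtain u A where A: "norm u = 1" "size A = n" "\<forall>a\<in>#A. norm a < 1"
       "\<forall>z\<in>ball 0 1. f z = u * (\<Prod>a\<in>#A. dbracket z a)"
    using assms(1) unfolding is_blaschke_product_iff_mset by blast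
  have "(\<lambda>z. \<Prod>a\<in>#A. dbracket z a) holomorphic_on ball 0 1"
    using A(3) by (induction A) (auto simp: dbracket_def intro!: holomorphic_intros Moebius_function_holomorphic)
  hence "(\<lambda>z. u * (\<Prod>a\<in>#A. dbracket z a)) holomorphic_on ball 0 1"
    by (intro holomorphic_intros)
  thus ?thesis by (rule holomorphic_transform) (use A(4) in auto)
qed

text \<open>
  From right to left, add \<open>0\<close> to the zeros. From left to right, \<open>0\<close> must be among the zeros of the
  product; cancelling the factor \<open>z\<close> identifies \<open>g\<close> away from the origin, and continuity at it.
\<close>

lemma is_blaschke_product_ident_mult_iff:
  assumes "g holomorphic_on ball 0 1"
  shows "is_blaschke_product (Suc n) (\<lambda>z. z * g z) \<longleftrightarrow> is_blaschke_product n g"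
proof
  assume "is_blaschke_product n g"
  then obtain u A where A: "norm u = 1" "size A = n" "\<forall>a\<in>#A. norm a < 1"
       "\<forall>z\<in>ball 0 1. g z = u * (\<Prod>a\<in>#A. dbracket z a)"
    unfolding is_blaschke_product_iff_mset by blast
  then show "is_blaschke_product (Suc n) (\<lambda>z. z * g z)"
    unfolding is_blaschke_product_iff_mset
    by (intro exI[of _ u] exI[of _ "add_mset 0 A"]) auto
next
  assume "is_blaschke_product (Suc n) (\<lambda>z. z * g z)"
  then obtain u A where A: "norm u = 1" "size A = Suc n" "\<forall>a\<in>#A. norm a < 1"
       "\<forall>z\<in>ball 0 1. z * g z = u * (\<Prod>a\<in>#A. dbracket z a)"
    unfolding is_blaschke_product_iff_mset by blast
  have "u * (\<Prod>a\<in>#A. dbracket 0 a) = 0" using A(4)[rule_format, of 0] by simp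
  hence "0 \<in># A" using A(1) by (auto simp: dbracket_altdef)
  then obtain B where B: "A = add_mset 0 B" by (metis multi_member_split)
  define h where "h z = u * (\<Prod>a\<in>#B. dbracket z a)" for z
  have h: "is_blaschke_product n h"
    unfolding is_blaschke_product_iff_mset h_def using A B by (intro exI[of _ u] exI[of _ B]) auto
  have eq: "g z = h z" if "z \<in> ball 0 1 - {0}" for z
    using A(4)[rule_format, of z] that by (auto simp: B h_def)
  have "g 0 = h 0"
  proof (rule tendsto_unique[OF _ _])
    have ev: "eventually (\<lambda>z. z \<in> ball 0 1 - {0}) (at (0::complex))"
      by (rule eventually_at_in_open) auto
    have "isCont g 0" "isCont h 0"
      using assms is_blaschke_product_holomorphic[OF h]
      by (auto intro!: continuous_on_interior[OF holomorphic_on_imp_continuous_on])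
    hence g: "(g \<longlongrightarrow> g 0) (at 0)" and h: "(h \<longlongrightarrow> h 0) (at 0)" by (auto simp: isCont_def)
    show "(g \<longlongrightarrow> g 0) (at 0)" by (rule g)
    show "(g \<longlongrightarrow> h 0) (at 0)"
      by (rule Lim_transform_eventually[OF h]) (use ev in eventually_elim, simp add: eq)
  qed simp
  with eq have "g z = h z" if "z \<in> ball 0 1" for z using that by (cases "z = 0") auto
  thus "is_blaschke_product n g" using h is_blaschke_product_cong by metis
qed

section \<open>One step of the Schur algorithm\<close>

definition schur_function :: "(complex \<Rightarrow> complex) \<Rightarrow> bool" where
  "schur_function f \<longleftrightarrow> f holomorphic_on ball 0 1 \<and> (\<forall>z\<in>ball 0 1. norm (f z) \<le> 1)"

lemma schur_function_unimodular_imp_const: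
  assumes f: "schur_function f" and w: "w \<in> ball 0 1" "norm (f w) = 1" and z: "z \<in> ball 0 1"
  shows "f z = f w"
proof -
  have "f constant_on ball 0 1"
    by (rule maximum_modulus_principle[of f _ "ball 0 1" w])
      (use f w in \<open>auto simp: schur_function_def\<close>)
  then show ?thesis using w z by (auto simp: constant_on_def)
qed

lemma schur_function_norm_less_one:
  assumes f: "schur_function f" and w: "w \<in> ball 0 1" "norm (f w) < 1" and z: "z \<in> ball 0 1"
  shows "norm (f z) < 1"
proof -
  have "norm (f z) \<noteq> 1"
    using schur_function_unimodular_imp_const[OF f z _ w(1)] w(2) by auto
  moreover have "norm (f z) \<le> 1" using f z by (simp add: schur_function_def)
  ultimately show ?thesis by simp
qed

lemma is_blaschke_product_0_iff:
  assumes "schur_function f"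
  shows "is_blaschke_product 0 f \<longleftrightarrow> norm (f 0) = 1"
proof
  assume *: "norm (f 0) = 1"
  define c where "c = f 0"
  have "\<forall>z\<in>ball 0 1. f z = c"
    unfolding c_def by (intro ballI schur_function_unimodular_imp_const[OF assms _ *]) auto
  with * show "is_blaschke_product 0 f"
    unfolding is_blaschke_product_iff_mset c_def[symmetric]
    by (intro exI[of _ c] exI[of _ "{#}"]) auto
qed (auto simp: is_blaschke_product_iff_mset)

lemma is_blaschke_product_has_zero:
  assumes "is_blaschke_product (Suc n) f"
  shows "\<exists>a\<in>ball 0 1. f a = 0"
proof -
  obtain u A where A: "size A = Suc n" "\<forall>a\<in>#A. norm a < 1"
       "\<forall>z\<in>ball 0 1. f z = u * (\<Prod>a\<in>#A. dbracket z a)"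
    using assms(1) unfolding is_blaschke_product_iff_mset by blast
  obtain a where a: "a \<in># A" using A(1) by (auto dest: size_eq_Suc_imp_elem)
  then obtain B where B: "A = add_mset a B" by (metis multi_member_split)
  have "a \<in> ball 0 1" using A(2) a by simp
  moreover from this have "f a = 0" using A(3) by (simp add: B)
  ultimately show ?thesis by blast
qed

text \<open>
  The Schwarz lemma for \<open>[f, f 0]\<close> makes the quotient by \<open>z\<close> a Schur function. The degree of a
  Blaschke product is preserved by \<open>[\<cdot>, f 0]\<close> and drops by one when the zero at the origin is removed.
\<close>

lemma schur_step:
  assumes f: "schur_function f" and f0: "norm (f 0) < 1"
  obtains g where "schur_function g"
    "\<And>z. z \<in> ball 0 1 \<Longrightarrow> dbracket (f z) (f 0) = z * g z"
    "\<And>n. is_blaschke_product (Suc n) f \<longleftrightarrow> is_blaschke_product n g"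
proof -
  have lt: "norm (f z) < 1" if "z \<in> ball 0 1" for z
    using schur_function_norm_less_one[OF f _ f0 that] by simp
  define F where "F z = dbracket (f z) (f 0)" for z
  have F0: "F 0 = 0" by (simp add: F_def)
  have Flt: "norm (F z) < 1" if "norm z < 1" for z
    using dbracket_in_disc[of "f z" "f 0"] lt[of z] f0 that by (auto simp: F_def)
  have "(Moebius_function 0 (f 0) \<circ> f) holomorphic_on ball 0 1"
    using f lt f0 by (intro holomorphic_on_compose_gen[OF _ Moebius_function_holomorphic])
      (auto simp: schur_function_def)
  hence F: "F holomorphic_on ball 0 1" by (simp add: F_def[abs_def] dbracket_def o_def)
  obtain g where g: "g holomorphic_on ball 0 1" "\<And>z. norm z < 1 \<Longrightarrow> F z = z * g z" "deriv F 0 = g 0"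
    using Schwarz3[OF F F0] by blast
  have "norm (g z) \<le> 1" if z: "norm z < 1" for z
  proof (cases "z = 0")
    case True
    then show ?thesis using Schwarz_Lemma(2)[OF F F0 Flt z] g(3) by simp
  next
    case False
    have "norm z * norm (g z) \<le> norm z * 1"
      using Schwarz_Lemma(1)[OF F F0 Flt z] g(2)[OF z] by (simp add: norm_mult)
    then show ?thesis using False by (simp add: mult_le_cancel_left)
  qed
  hence "schur_function g" using g by (auto simp: schur_function_def)
  moreover have "is_blaschke_product (Suc n) f \<longleftrightarrow> is_blaschke_product n g" for n
  proof -
    have "is_blaschke_product (Suc n) f \<longleftrightarrow> is_blaschke_product (Suc n) F"
      unfolding F_def[abs_def] using lt f0 by (intro is_blaschke_product_dbracket_left_iff[symmetric])
    also have "\<dots> \<longleftrightarrow> is_blaschke_product (Suc n) (\<lambda>z. z * g z)"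
      by (intro is_blaschke_product_cong g) auto
    also have "\<dots> \<longleftrightarrow> is_blaschke_product n g"
      by (rule is_blaschke_product_ident_mult_iff[OF g(1)])
    finally show ?thesis .
  qed
  ultimately show thesis using that[of g] g(2) by (auto simp: F_def)
qed

lemma schur_function_has_fps_expansion:
  assumes "schur_function f"
  shows "f has_fps_expansion fps_expansion f 0"
  using assms by (intro has_fps_expansion_fps_expansion[of "ball 0 1"]) (auto simp: schur_function_def)

lemma fps_nth_fps_expansion_0: "fps_nth (fps_expansion f 0) 0 = f 0"
  by (simp add: fps_expansion_def)

lemma fps_expansion_const_on_disc:
  assumes "\<And>z. z \<in> ball 0 1 \<Longrightarrow> f z = c" "n > 0"
  shows "fps_nth (fps_expansion f 0) n = 0"
proof -
  have "eventually (\<lambda>z. f z = c) (nhds 0)"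
    using eventually_nhds_in_open[of "ball 0 1" 0] by (rule eventually_mono) (use assms in auto)
  hence "f has_fps_expansion fps_const c"
    by (subst has_fps_expansion_cong[where g="\<lambda>_. c"]) auto
  with assms(2) show ?thesis by (simp add: fps_expansion_eqI)
qed

text \<open>
  Clearing the denominator in \<open>[f z, f 0] = z * g z\<close> gives an identity between power series, from
  which the coefficients of \<open>f\<close> can be read off in terms of those of \<open>g\<close>.
\<close>

lemma schur_step_fps:
  assumes f: "schur_function f" and f0: "norm (f 0) < 1" and g: "schur_function g"
    and fg: "\<And>z. z \<in> ball 0 1 \<Longrightarrow> dbracket (f z) (f 0) = z * g z"
  defines "F \<equiv> fps_expansion f 0" and "G \<equiv> fps_expansion g 0"
  shows "F - fps_const (f 0) = fps_X * (G * (1 - fps_const (cnj (f 0)) * F))"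
proof -
  have eq: "f z - f 0 = z * (g z * (1 - cnj (f 0) * f z))" if "z \<in> ball 0 1" for z
  proof -
    have "1 - cnj (f 0) * f z \<noteq> 0"
      using f f0 that by (intro one_minus_mult_nonzero) (auto simp: schur_function_def)
    with fg[OF that] show ?thesis by (simp add: dbracket_altdef field_simps)
  qed
  have "(\<lambda>z. z * (g z * (1 - cnj (f 0) * f z))) has_fps_expansion fps_X * (G * (1 - fps_const (cnj (f 0)) * F))"
    unfolding F_def G_def
    by (intro fps_expansion_intros schur_function_has_fps_expansion f g)
  moreover have "(\<lambda>z. f z - f 0) has_fps_expansion F - fps_const (f 0)"
    unfolding F_def by (intro fps_expansion_intros schur_function_has_fps_expansion f)
  hence "(\<lambda>z. z * (g z * (1 - cnj (f 0) * f z))) has_fps_expansion F - fps_const (f 0)"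
    by (rule has_fps_expansion_cong[THEN iffD1, rotated -1])
       (use eventually_nhds_in_open[of "ball 0 1" "0::complex"] eq in \<open>auto elim!: eventually_mono\<close>)
  ultimately show ?thesis by (rule fps_expansion_unique_complex[rotated])
qed

lemma schur_step_coeffs:
  assumes f: "schur_function f" and f0: "norm (f 0) < 1" and g: "schur_function g"
    and fg: "\<And>z. z \<in> ball 0 1 \<Longrightarrow> dbracket (f z) (f 0) = z * g z"
  defines "F \<equiv> fps_expansion f 0" and "G \<equiv> fps_expansion g 0"
  shows "fps_nth F 1 = of_real (1 - (norm (f 0))\<^sup>2) * g 0"
    and "fps_nth F 2 = of_real (1 - (norm (f 0))\<^sup>2) * fps_nth G 1 - cnj (f 0) * g 0 * fps_nth F 1"
proof -
  have eq: "F - fps_const (f 0) = fps_X * (G * (1 - fps_const (cnj (f 0)) * F))"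
    unfolding F_def G_def by (rule schur_step_fps) fact+
  have sq: "of_real (1 - (norm (f 0))\<^sup>2) = 1 - cnj (f 0) * f 0"
    by (simp only: of_real_diff of_real_1 complex_norm_square mult.commute)
  have F0: "fps_nth F 0 = f 0" "fps_nth G 0 = g 0"
    by (simp_all add: F_def G_def fps_nth_fps_expansion_0)
  have "fps_nth F (Suc n) = fps_nth (G * (1 - fps_const (cnj (f 0)) * F)) n" for n
    using arg_cong[OF eq, of "\<lambda>H. fps_nth H (Suc n)"] by simp
  note nth = this[of 0] this[of 1]
  show "fps_nth F 1 = of_real (1 - (norm (f 0))\<^sup>2) * g 0"
    using nth(1) F0 unfolding sq by simp
  show "fps_nth F 2 = of_real (1 - (norm (f 0))\<^sup>2) * fps_nth G 1 - cnj (f 0) * g 0 * fps_nth F 1"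
    using nth(2) F0 unfolding sq by (simp add: fps_mult_nth_1 numeral_2_eq_2)
qed

section \<open>Coefficient bounds for Schur functions\<close>

lemma schur_unimodular_coeff:
  assumes "schur_function f" "norm (f 0) = 1" "n > 0"
  shows "fps_nth (fps_expansion f 0) n = 0"
proof (rule fps_expansion_const_on_disc[OF _ assms(3)])
  show "f z = f 0" if "z \<in> ball 0 1" for z
    by (rule schur_function_unimodular_imp_const[OF assms(1) _ assms(2) that]) simp
qed

text \<open>
  This is the Schwarz-Pick inequality at the origin. If \<open>f\<close> is not constant of modulus one, a Schur step to
  \<open>g\<close> turns \<open>\<bar>f' 0\<bar>\<close> into \<open>(1 - \<bar>f 0\<bar>\<^sup>2) * \<bar>g 0\<bar>\<close>, so the defect in the inequality is a positive multiple
  of \<open>1 - \<bar>g 0\<bar>\<close>, and equality means that \<open>g\<close> is a unimodular constant.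
\<close>

lemma schur_coeff_bound_1:
  assumes f: "schur_function f"
  defines "F \<equiv> fps_expansion f 0"
  shows "norm (fps_nth F 1) + (norm (f 0))\<^sup>2 \<le> 1"
    and "norm (fps_nth F 1) + (norm (f 0))\<^sup>2 = 1 \<longleftrightarrow>
           is_blaschke_product 0 f \<or> is_blaschke_product 1 f"
proof -
  have "norm (fps_nth F 1) + (norm (f 0))\<^sup>2 \<le> 1 \<and>
        (norm (fps_nth F 1) + (norm (f 0))\<^sup>2 = 1 \<longleftrightarrow>
           is_blaschke_product 0 f \<or> is_blaschke_product 1 f)"
  proof (cases "norm (f 0) = 1")
    case True
    have "fps_nth F 1 = 0"
      unfolding F_def by (rule schur_unimodular_coeff[OF f True]) simp
    with True show ?thesis by (simp add: is_blaschke_product_0_iff[OF f])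
  next
    case False
    with f have f0: "norm (f 0) < 1" by (simp add: schur_function_def order_less_le)
    obtain g where g: "schur_function g"
        "\<And>z. z \<in> ball 0 1 \<Longrightarrow> dbracket (f z) (f 0) = z * g z"
        "\<And>n. is_blaschke_product (Suc n) f \<longleftrightarrow> is_blaschke_product n g"
      using schur_step[OF f f0] by blast
    define d where "d = 1 - (norm (f 0))\<^sup>2"
    have d: "d > 0" using f0 by (simp add: d_def abs_square_less_1)
    have "fps_nth F 1 = of_real d * g 0"
      unfolding F_def d_def by (rule schur_step_coeffs(1)[OF f f0 g(1,2)])
    hence "norm (fps_nth F 1) = d * norm (g 0)" using d by (simp add: norm_mult)
    hence "norm (fps_nth F 1) + (norm (f 0))\<^sup>2 = 1 - d * (1 - norm (g 0))"
      by (simp add: d_def algebra_simps)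
    moreover have "norm (g 0) \<le> 1" using g(1) by (simp add: schur_function_def)
    moreover have "is_blaschke_product 0 f \<or> is_blaschke_product 1 f \<longleftrightarrow> norm (g 0) = 1"
      using g(3)[of 0] False by (simp add: is_blaschke_product_0_iff f g(1))
    ultimately show ?thesis using d by simp
  qed
  thus "norm (fps_nth F 1) + (norm (f 0))\<^sup>2 \<le> 1"
    and "norm (fps_nth F 1) + (norm (f 0))\<^sup>2 = 1 \<longleftrightarrow>
           is_blaschke_product 0 f \<or> is_blaschke_product 1 f" by blast+
qed

text \<open>
  The left-hand side looks unsymmetric in \<open>f\<close>, but the term \<open>cnj (f 0) * (fps_nth F 1)\<^sup>2\<close> is just what
  cancels the nonlinear part of the second coefficient: after a Schur step to \<open>g\<close> the left-hand side
  is \<open>(1 - \<bar>f 0\<bar>\<^sup>2)\<^sup>2\<close> times the one that \<open>schur_coeff_bound_1\<close> bounds for \<open>g\<close>.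
\<close>

lemma schur_coeff_bound_2:
  assumes f: "schur_function f"
  defines "F \<equiv> fps_expansion f 0"
  defines "L \<equiv> norm (fps_nth F 2 * of_real (1 - (norm (f 0))\<^sup>2) + cnj (f 0) * (fps_nth F 1)\<^sup>2)
                 + (norm (fps_nth F 1))\<^sup>2"
  shows "L \<le> (1 - (norm (f 0))\<^sup>2)\<^sup>2"
    and "L = (1 - (norm (f 0))\<^sup>2)\<^sup>2 \<longleftrightarrow>
           is_blaschke_product 0 f \<or> is_blaschke_product 1 f \<or> is_blaschke_product 2 f"
proof -
  have "L \<le> (1 - (norm (f 0))\<^sup>2)\<^sup>2 \<and> (L = (1 - (norm (f 0))\<^sup>2)\<^sup>2 \<longleftrightarrow>
           is_blaschke_product 0 f \<or> is_blaschke_product 1 f \<or> is_blaschke_product 2 f)"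
  proof (cases "norm (f 0) = 1")
    case True
    have "fps_nth F n = 0" if "n > 0" for n
      unfolding F_def by (rule schur_unimodular_coeff[OF f True that])
    with True show ?thesis by (simp add: is_blaschke_product_0_iff[OF f] L_def)
  next
    case False
    with f have f0: "norm (f 0) < 1" by (simp add: schur_function_def order_less_le)
    obtain g where g: "schur_function g"
        "\<And>z. z \<in> ball 0 1 \<Longrightarrow> dbracket (f z) (f 0) = z * g z"
        "\<And>n. is_blaschke_product (Suc n) f \<longleftrightarrow> is_blaschke_product n g"
      using schur_step[OF f f0] by blast
    define d where "d = 1 - (norm (f 0))\<^sup>2"
    define G1 where "G1 = fps_nth (fps_expansion g 0) 1"
    have d: "d > 0" using f0 by (simp add: d_def abs_square_less_1)
    have F1: "fps_nth F 1 = of_real d * g 0"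
      unfolding F_def d_def by (rule schur_step_coeffs(1)[OF f f0 g(1,2)])
    have F2: "fps_nth F 2 = of_real d * G1 - cnj (f 0) * g 0 * fps_nth F 1"
      unfolding F_def d_def G1_def by (rule schur_step_coeffs(2)[OF f f0 g(1,2)])
    have "fps_nth F 2 * of_real d + cnj (f 0) * (fps_nth F 1)\<^sup>2 = (of_real d)\<^sup>2 * G1"
      unfolding F2 F1 by (simp add: algebra_simps power2_eq_square)
    hence L: "L = d\<^sup>2 * (norm G1 + (norm (g 0))\<^sup>2)"
      unfolding L_def d_def[symmetric] F1
      by (simp add: norm_mult norm_power power_mult_distrib distrib_left)
    have "\<not> is_blaschke_product 0 f" "is_blaschke_product 1 f \<longleftrightarrow> is_blaschke_product 0 g"
         "is_blaschke_product 2 f \<longleftrightarrow> is_blaschke_product 1 g"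
      using False g(3)[of 0] g(3)[of 1] by (simp_all add: is_blaschke_product_0_iff f numeral_2_eq_2)
    hence "is_blaschke_product 0 f \<or> is_blaschke_product 1 f \<or> is_blaschke_product 2 f
             \<longleftrightarrow> norm G1 + (norm (g 0))\<^sup>2 = 1"
      unfolding G1_def by (simp only: schur_coeff_bound_1(2)[OF g(1)]) simp
    moreover have "norm G1 + (norm (g 0))\<^sup>2 \<le> 1"
      unfolding G1_def by (rule schur_coeff_bound_1(1)[OF g(1)])
    ultimately show ?thesis unfolding L d_def[symmetric] using d by simp
  qed
  thus "L \<le> (1 - (norm (f 0))\<^sup>2)\<^sup>2"
    and "L = (1 - (norm (f 0))\<^sup>2)\<^sup>2 \<longleftrightarrow>
           is_blaschke_product 0 f \<or> is_blaschke_product 1 f \<or> is_blaschke_product 2 f" by blast+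
qed

section \<open>Peschl's invariant derivatives\<close>

lemma peschl_aux_0 [simp]: "peschl_aux f z 0 = 0"
  by (simp add: peschl_aux_def dbracket_altdef)

text \<open>
  The function \<open>peschl_aux f z\<close> is \<open>f\<close> between two disc automorphisms, normalised to vanish at the
  origin. A Schur step with value \<open>0\<close> at the origin only divides by the variable, which shifts the
  coefficients by one place.
\<close>

lemma peschl_deriv_eq_schur_coeff:
  assumes f: "schur_function f" and z: "z \<in> ball 0 1" "norm (f z) < 1"
  obtains h where "schur_function h"
    "\<And>n. peschl_deriv (Suc n) f z = fact (Suc n) * fps_nth (fps_expansion h 0) n"
    "\<And>n. is_blaschke_product (Suc n) f \<longleftrightarrow> is_blaschke_product n h"
proof -
  let ?P = "peschl_aux f z"
  have lt: "norm (f w) < 1" if "w \<in> ball 0 1" for w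
    using schur_function_norm_less_one[OF f z that] .
  have lt': "norm (f (dbracket w (- z))) < 1" if "w \<in> ball 0 1" for w
    by (rule lt) (use dbracket_in_disc[OF that, of "- z"] z in auto)
  have "norm (?P w) \<le> 1" if "w \<in> ball 0 1" for w
    using dbracket_in_disc[of "f (dbracket w (- z))" "f z"] lt'[OF that] z
    by (simp add: peschl_aux_def)
  moreover have "?P holomorphic_on ball 0 1"
    using f z by (intro peschl_aux_holomorphic) (auto simp: schur_function_def)
  ultimately have P: "schur_function ?P" by (simp add: schur_function_def)
  obtain h where h: "schur_function h" "\<And>w. w \<in> ball 0 1 \<Longrightarrow> dbracket (?P w) (?P 0) = w * h w"
    "\<And>n. is_blaschke_product (Suc n) ?P \<longleftrightarrow> is_blaschke_product n h"
    using schur_step[OF P] by auto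
  have "fps_expansion ?P 0 = fps_X * fps_expansion h 0"
    using schur_step_fps[OF P _ h(1,2)] by simp
  hence "peschl_deriv (Suc n) f z = fact (Suc n) * fps_nth (fps_expansion h 0) n" for n
    unfolding peschl_deriv_def by simp
  moreover have "is_blaschke_product n f \<longleftrightarrow> is_blaschke_product n ?P" for n
  proof -
    have "is_blaschke_product n ?P \<longleftrightarrow> is_blaschke_product n (\<lambda>w. f (dbracket w (- z)))"
      unfolding peschl_aux_def[abs_def]
      using z by (intro is_blaschke_product_dbracket_left_iff lt')
    also have "\<dots> \<longleftrightarrow> is_blaschke_product n f"
      using z by (intro is_blaschke_product_dbracket_right_iff) auto
    finally show ?thesis ..
  qed
  ultimately show thesis using that[of h] h by blast
qed

theorem theorem3p5:
  fixes f :: "complex \<Rightarrow> complex" and z :: complex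
  assumes "f holomorphic_on ball 0 1"
    and "\<And>w. w \<in> ball 0 1 \<Longrightarrow> norm (f w) \<le> 1"
    and "z \<in> ball 0 1"
  shows
    "norm (peschl_deriv 3 f z / 6 * (1 - of_real ((norm (peschl_deriv 1 f z))\<^sup>2))
           + cnj (peschl_deriv 1 f z) * (peschl_deriv 2 f z / 2)\<^sup>2)
         + (norm (peschl_deriv 2 f z / 2))\<^sup>2
       \<le> (1 - (norm (peschl_deriv 1 f z))\<^sup>2)\<^sup>2 \<and>
     (norm (peschl_deriv 3 f z / 6 * (1 - of_real ((norm (peschl_deriv 1 f z))\<^sup>2))
           + cnj (peschl_deriv 1 f z) * (peschl_deriv 2 f z / 2)\<^sup>2)
         + (norm (peschl_deriv 2 f z / 2))\<^sup>2
       = (1 - (norm (peschl_deriv 1 f z))\<^sup>2)\<^sup>2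
       \<longleftrightarrow> (\<exists>n. 1 \<le> n \<and> n \<le> 3 \<and> is_blaschke_product n f))"
proof (cases "norm (f z) = 1")
  \<comment> \<open>A unimodular constant: the invariant derivatives vanish, the inequality is the strict
    \<open>0 < 1\<close>, and \<open>f\<close> has no zero, as a Blaschke product of positive degree would.\<close>
  case True
  have f: "schur_function f" using assms by (simp add: schur_function_def)
  have const: "f w = f z" if "w \<in> ball 0 1" for w
    by (rule schur_function_unimodular_imp_const[OF f assms(3) True that])
  have aux: "peschl_aux f z w = 0" if "w \<in> ball 0 1" for w
    unfolding peschl_aux_def
    by (subst const) (use dbracket_in_disc[OF that, of "- z"] assms(3) in simp_all)
  have D: "peschl_deriv n f z = 0" if "n > 0" for n
    unfolding peschl_deriv_def using fps_expansion_const_on_disc[OF aux that] by simp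
  have "\<not> is_blaschke_product n f" if n: "1 \<le> n" for n
  proof
    assume *: "is_blaschke_product n f"
    obtain m where "n = Suc m" using n by (cases n) auto
    with * obtain a where "a \<in> ball 0 1" "f a = 0" using is_blaschke_product_has_zero by metis
    with const[of a] True show False by simp
  qed
  thus ?thesis by (auto simp: D)
next
  case False
  have f: "schur_function f" using assms by (simp add: schur_function_def)
  have fz: "norm (f z) < 1" using False assms(2)[OF assms(3)] by simp
  obtain h where h: "schur_function h"
    "\<And>n. peschl_deriv (Suc n) f z = fact (Suc n) * fps_nth (fps_expansion h 0) n"
    "\<And>n. is_blaschke_product (Suc n) f \<longleftrightarrow> is_blaschke_product n h"
    using peschl_deriv_eq_schur_coeff[OF f assms(3) fz] by blast
  have D: "peschl_deriv 1 f z = h 0" "peschl_deriv 2 f z / 2 = fps_nth (fps_expansion h 0) 1"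
    "peschl_deriv 3 f z / 6 = fps_nth (fps_expansion h 0) 2"
    using h(2)[of 0] h(2)[of 1] h(2)[of 2]
    by (simp_all add: fps_nth_fps_expansion_0 fact_numeral flip: numeral_2_eq_2 numeral_3_eq_3)
  have "1 \<le> n \<and> n \<le> 3 \<longleftrightarrow> n = 1 \<or> n = 2 \<or> n = 3" for n :: nat by auto
  hence "(\<exists>n. 1 \<le> n \<and> n \<le> 3 \<and> is_blaschke_product n f) \<longleftrightarrow>
        (\<exists>n\<in>{1,2,3}. is_blaschke_product n f)"
    by blast
  also have "\<dots> \<longleftrightarrow> is_blaschke_product 0 h \<or> is_blaschke_product 1 h \<or> is_blaschke_product 2 h"
    using h(3)[of 0] h(3)[of 1] h(3)[of 2] by (simp add: numeral_2_eq_2 numeral_3_eq_3)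
  finally show ?thesis
    using schur_coeff_bound_2[OF h(1)] unfolding D by simp
qed

end
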